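(* Let $K$ be a field, $X$ a set, and $\Omega$ a set of multilinear operations as in the context. Every finitely generated $\Omega$-ideal of the free $\Omega$-algebra $K\{X\}_{\Omega}$ has a finite Gröbner basis with respect to any admissible ordering on $\{X\}_{\Omega}$.
   Context: $\Omega=\bigcup_{n\ge 2}\Omega_n$, where $\Omega_n=\{\nu_{ni}\mid i=1,\ldots,p_n\}$ is a finite set (possibly empty) of $n$-ary operation symbols. The free $\Omega$-magma $\{X\}_{\Omega}$ (the set of $\Omega$-monomials) is the smallest set of formal expressions containing $X$ and containing $\nu_{ni}(u_1,\ldots,u_n)$ whenever $\nu_{ni}\in\Omega$ and $u_1,\ldots,u_n\in\{X\}_{\Omega}$. The (nonunitary) free $\Omega$-algebra $K\{X\}_{\Omega}$ is the $K$-vector space with basis $\{X\}_{\Omega}$, with the operations of $\Omega$ extended multilinearly. An $\Omega$-ideal is a subspace $J$ such that $\nu_{ni}(u_1,\ldots,u_n)\in J$ whenever some $u_j\in J$; it is finitely generated if it is the smallest $\Omega$-ideal containing some finite set. An admissible ordering $\prec$ on $\{X\}_{\Omega}$ is a well-ordering such that $u\prec v$ implies $\nu_{ni}(w_1,\ldots,w_{j-1},u,w_{j+1},\ldots,w_n)\prec\nu_{ni}(w_1,\ldots,w_{j-1},v,w_{j+1},\ldots,w_n)$ for all $\nu_{ni}\in\Omega$ and $w_i\in\{X\}_{\Omega}$. The leading term $\overline f$ of $0\ne f\in K\{X\}_{\Omega}$ is the largest $\Omega$-monomial occurring in $f$ with nonzero coefficient. The subwords of an $\Omega$-monomial $u$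 are $u$ itself and, if $u=\nu_{ni}(u_1,\ldots,u_n)$, all subwords of $u_1,\ldots,u_n$. A subset $B$ of $J$ is a Gröbner basis of $J$ if for every $0\neq f\in J$ there is $g\in B$, $g\neq 0$, such that $\overline g$ is a subword of $\overline f$. *)

theory Defs
  imports Complex_Main "HOL-Library.Poly_Mapping"
begin

text \<open>
  Formal expressions over generators of type \<^typ>\<open>'x\<close> and operation symbols of type \<^typ>\<open>'f\<close>;
  arities are enforced only by \<open>omega_magma\<close> below.
\<close>

datatype ('f, 'x) oterm = Gen 'x | Op 'f "('f, 'x) oterm list"

text \<open>
  The symbols in \<open>\<Omega>\<close> carry an arity, and \<open>\<Omega>\<^sub>n = {\<nu> \<in> \<Omega>. ar \<nu> = n}\<close>.
\<close>

definition omega_signature :: "'f set \<Rightarrow> ('f \<Rightarrow> nat) \<Rightarrow> bool" where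
  "omega_signature \<Omega> ar \<longleftrightarrow>
     (\<forall>\<nu>\<in>\<Omega>. 2 \<le> ar \<nu>) \<and> (\<forall>n. finite {\<nu> \<in> \<Omega>. ar \<nu> = n})"

inductive_set omega_magma :: "'f set \<Rightarrow> ('f \<Rightarrow> nat) \<Rightarrow> 'x set \<Rightarrow> ('f, 'x) oterm set"
  for \<Omega> :: "'f set" and ar :: "'f \<Rightarrow> nat" and X :: "'x set" where
  Gen: "x \<in> X \<Longrightarrow> Gen x \<in> omega_magma \<Omega> ar X"
| Op: "\<nu> \<in> \<Omega> \<Longrightarrow> length us = ar \<nu> \<Longrightarrow> (\<And>u. u \<in> set us \<Longrightarrow> u \<in> omega_magma \<Omega> ar X)
        \<Longrightarrow> Op \<nu> us \<in> omega_magma \<Omega> ar X"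

fun subwords :: "('f, 'x) oterm \<Rightarrow> ('f, 'x) oterm set" where
  "subwords (Gen x) = {Gen x}"
| "subwords (Op \<nu> us) = insert (Op \<nu> us) (\<Union>u\<in>set us. subwords u)"

definition pm_scale :: "'k \<Rightarrow> ('a \<Rightarrow>\<^sub>0 'k::field) \<Rightarrow> 'a \<Rightarrow>\<^sub>0 'k" where
  "pm_scale c f = Poly_Mapping.map ((*) c) f"

lemma lookup_pm_scale: "Poly_Mapping.lookup (pm_scale c f) u = c * Poly_Mapping.lookup f u"
  by (simp add: pm_scale_def map.rep_eq when_def in_keys_iff)

interpretation pm_vs: vector_space "pm_scale :: 'k::field \<Rightarrow> ('a \<Rightarrow>\<^sub>0 'k) \<Rightarrow> 'a \<Rightarrow>\<^sub>0 'k"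
  by unfold_locales (auto intro!: poly_mapping_eqI simp: lookup_pm_scale lookup_add algebra_simps)

definition free_omega_algebra ::
  "'f set \<Rightarrow> ('f \<Rightarrow> nat) \<Rightarrow> 'x set \<Rightarrow> (('f, 'x) oterm \<Rightarrow>\<^sub>0 'k::field) set" where
  "free_omega_algebra \<Omega> ar X = {f. Poly_Mapping.keys f \<subseteq> omega_magma \<Omega> ar X}"

text \<open>
  The multilinear extension of an operation: expand each argument in the monomial basis;
  \<open>listset\<close> ranges over all choices of one monomial from the support of each argument.
\<close>

definition omega_op ::
  "'f \<Rightarrow> (('f, 'x) oterm \<Rightarrow>\<^sub>0 'k::field) list \<Rightarrow> ('f, 'x) oterm \<Rightarrow>\<^sub>0 'k" where
  "omega_op \<nu> fs =
     (\<Sum>us\<in>listset (map Poly_Mapping.keys fs).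
        Poly_Mapping.single (Op \<nu> us) (\<Prod>i<length fs. Poly_Mapping.lookup (fs ! i) (us ! i)))"

lemma omega_op_monomials:
  "omega_op \<nu> (map (\<lambda>u. Poly_Mapping.single u (1::'k::field)) us) =
     Poly_Mapping.single (Op \<nu> us) 1"
proof -
  have "listset (map Poly_Mapping.keys (map (\<lambda>u. Poly_Mapping.single u (1::'k)) us)) = {us}"
    by (induction us) (auto simp: set_Cons_def)
  then show ?thesis
    by (simp add: omega_op_def)
qed

definition omega_ideal ::
  "'f set \<Rightarrow> ('f \<Rightarrow> nat) \<Rightarrow> 'x set \<Rightarrow> (('f, 'x) oterm \<Rightarrow>\<^sub>0 'k::field) set \<Rightarrow> bool" where
  "omega_ideal \<Omega> ar X J \<longleftrightarrow>
     J \<subseteq> free_omega_algebra \<Omega> ar X \<and> pm_vs.subspace J \<and>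
     (\<forall>\<nu>\<in>\<Omega>. \<forall>fs\<in>lists (free_omega_algebra \<Omega> ar X).
        length fs = ar \<nu> \<and> (\<exists>j<length fs. fs ! j \<in> J) \<longrightarrow> omega_op \<nu> fs \<in> J)"

definition fin_gen_omega_ideal ::
  "'f set \<Rightarrow> ('f \<Rightarrow> nat) \<Rightarrow> 'x set \<Rightarrow> (('f, 'x) oterm \<Rightarrow>\<^sub>0 'k::field) set \<Rightarrow> bool" where
  "fin_gen_omega_ideal \<Omega> ar X J \<longleftrightarrow>
     omega_ideal \<Omega> ar X J \<and>
     (\<exists>S. finite S \<and> S \<subseteq> J \<and> (\<forall>I. omega_ideal \<Omega> ar X I \<and> S \<subseteq> I \<longrightarrow> J \<subseteq> I))"

text \<open>
  Orderings are given, as in \<open>well_order_on\<close>, by the reflexive relation \<open>r\<close>; the strict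
  ordering \<open>u \<prec> v\<close> is \<open>(u, v) \<in> r - Id\<close>.
\<close>

definition admissible_ordering ::
  "'f set \<Rightarrow> ('f \<Rightarrow> nat) \<Rightarrow> 'x set \<Rightarrow> ('f, 'x) oterm rel \<Rightarrow> bool" where
  "admissible_ordering \<Omega> ar X r \<longleftrightarrow>
     well_order_on (omega_magma \<Omega> ar X) r \<and>
     (\<forall>\<nu>\<in>\<Omega>. \<forall>ws\<in>lists (omega_magma \<Omega> ar X). \<forall>j<length ws. \<forall>u v.
        length ws = ar \<nu> \<and> (u, v) \<in> r - Id \<longrightarrow>
        (Op \<nu> (ws[j := u]), Op \<nu> (ws[j := v])) \<in> r - Id)"

text \<open>Meaningful only for nonzero \<open>f\<close> supported on the field of the linear order \<open>r\<close>.\<close>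

definition leading_term ::
  "('f, 'x) oterm rel \<Rightarrow> (('f, 'x) oterm \<Rightarrow>\<^sub>0 'k::field) \<Rightarrow> ('f, 'x) oterm" where
  "leading_term r f =
     (THE u. u \<in> Poly_Mapping.keys f \<and> (\<forall>v\<in>Poly_Mapping.keys f. (v, u) \<in> r))"

definition groebner_basis ::
  "('f, 'x) oterm rel \<Rightarrow> (('f, 'x) oterm \<Rightarrow>\<^sub>0 'k::field) set \<Rightarrow>
   (('f, 'x) oterm \<Rightarrow>\<^sub>0 'k) set \<Rightarrow> bool" where
  "groebner_basis r J B \<longleftrightarrow>
     B \<subseteq> J \<and>
     (\<forall>f\<in>J. f \<noteq> 0 \<longrightarrow> (\<exists>g\<in>B. g \<noteq> 0 \<and> leading_term r g \<in> subwords (leading_term r f)))"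

end

theory Submission imports Defs begin

text \<open>
  Among the leading terms of the nonzero elements of \<open>J\<close>, call minimal those none of whose
  proper subwords is again a leading term. Since words have finitely many subwords, choosing one
  element of \<open>J\<close> for each minimal leading term always gives a Groebner basis, so the
  point is that a finitely generated \<open>J\<close> has only finitely many minimal leading terms.

  Let \<open>D \<subseteq> J\<close> be the subspace spanned by all values of operations that have at least one
  argument in \<open>J\<close>. If a finite set \<open>S\<close> generates \<open>J\<close>, then \<open>span S + D\<close> is
  already an ideal, so \<open>J = span S + D\<close> and \<open>J / D\<close> has finite dimension. It therefore
  suffices that elements of \<open>J\<close> with distinct minimal leading terms are linearly independent
  modulo \<open>D\<close> (lemma \<open>finite_minimal_leading_terms\<close>). A nontrivial combination of
  such elements has a minimal leading term, so this amounts to showing that no nonzero element of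
  \<open>D\<close> has a minimal leading term (lemma \<open>leading_term_decomposable_not_minimal\<close>).

  For that, let \<open>\<rho>\<close> be the linear map sending each element to its normal form modulo \<open>J\<close>,
  that is, the projection along \<open>J\<close> onto the span of the monomials that are not leading terms.
  Let \<open>\<Phi>\<close> be the linear map that applies \<open>\<rho>\<close> to every argument of the outermost operation
  of a monomial. It kills \<open>D\<close>, because \<open>\<rho>\<close> kills \<open>J\<close>. On the other hand, it fixes a
  minimal leading term \<open>u\<close>, whose arguments are already normal, and by admissibility of the ordering
  it sends a monomial smaller than \<open>u\<close> to a combination of monomials smaller than \<open>u\<close>.
  Hence \<open>\<Phi>\<close> cannot kill an element whose leading term is \<open>u\<close>.
\<close>

section \<open>Linear extension from monomials\<close>

definition linear_extension :: "('a \<Rightarrow> 'b \<Rightarrow>\<^sub>0 'k) \<Rightarrow> ('a \<Rightarrow>\<^sub>0 'k::field) \<Rightarrow> 'b \<Rightarrow>\<^sub>0 'k" where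
  "linear_extension h f =
     (\<Sum>u\<in>Poly_Mapping.keys f. pm_scale (Poly_Mapping.lookup f u) (h u))"

lemma linear_extension_superset:
  assumes "finite U" "Poly_Mapping.keys f \<subseteq> U"
  shows "linear_extension h f = (\<Sum>u\<in>U. pm_scale (Poly_Mapping.lookup f u) (h u))"
  unfolding linear_extension_def
  using assms by (intro sum.mono_neutral_left) (auto simp: in_keys_iff)

lemma linear_extension_add:
  "linear_extension h (f + g) = linear_extension h f + linear_extension h g"
proof -
  let ?U = "Poly_Mapping.keys f \<union> Poly_Mapping.keys g"
  have "linear_extension h k = (\<Sum>u\<in>?U. pm_scale (Poly_Mapping.lookup k u) (h u))"
    if "Poly_Mapping.keys k \<subseteq> ?U" for k
    using that by (intro linear_extension_superset) auto
  then show ?thesis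
    using keys_add[of f g]
    by (simp add: lookup_add pm_vs.scale_left_distrib sum.distrib)
qed

lemma linear_extension_scale:
  "linear_extension h (pm_scale c f) = pm_scale c (linear_extension h f)"
proof -
  have "Poly_Mapping.keys (pm_scale c f) \<subseteq> Poly_Mapping.keys f"
    by (auto simp: in_keys_iff lookup_pm_scale)
  then have "linear_extension h (pm_scale c f) =
      (\<Sum>u\<in>Poly_Mapping.keys f. pm_scale (Poly_Mapping.lookup (pm_scale c f) u) (h u))"
    by (intro linear_extension_superset) auto
  then show ?thesis
    by (simp add: linear_extension_def lookup_pm_scale pm_vs.scale_sum_right)
qed

lemma linear_extension_zero [simp]: "linear_extension h 0 = 0"
  by (simp add: linear_extension_def)

lemma linear_extension_sum:
  "linear_extension h (\<Sum>i\<in>I. F i) = (\<Sum>i\<in>I. linear_extension h (F i))"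
  by (induction I rule: infinite_finite_induct) (auto simp: linear_extension_add)

lemma linear_extension_single:
  "linear_extension h (Poly_Mapping.single u c) = pm_scale c (h u)"
  by (cases "c = 0") (auto simp: linear_extension_def)

lemma lookup_linear_extension:
  "Poly_Mapping.lookup (linear_extension h f) w =
     (\<Sum>u\<in>Poly_Mapping.keys f. Poly_Mapping.lookup f u * Poly_Mapping.lookup (h u) w)"
  by (simp add: linear_extension_def lookup_sum lookup_pm_scale)

lemma keys_linear_extension:
  "Poly_Mapping.keys (linear_extension h f) \<subseteq>
     (\<Union>u\<in>Poly_Mapping.keys f. Poly_Mapping.keys (h u))"
proof
  fix w assume "w \<in> Poly_Mapping.keys (linear_extension h f)"
  then have "(\<Sum>u\<in>Poly_Mapping.keys f. Poly_Mapping.lookup f u * Poly_Mapping.lookup (h u) w) \<noteq> 0"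
    by (simp add: in_keys_iff lookup_linear_extension)
  then obtain u where "u \<in> Poly_Mapping.keys f"
    "Poly_Mapping.lookup f u * Poly_Mapping.lookup (h u) w \<noteq> 0"
    by (meson sum.neutral)
  then show "w \<in> (\<Union>u\<in>Poly_Mapping.keys f. Poly_Mapping.keys (h u))"
    by (auto simp: in_keys_iff)
qed

lemma monomial_expansion:
  "(\<Sum>u\<in>Poly_Mapping.keys f.
      pm_scale (Poly_Mapping.lookup f u) (Poly_Mapping.single u (1::'k::field))) = f"
proof (rule poly_mapping_eqI)
  fix w
  show "Poly_Mapping.lookup (\<Sum>u\<in>Poly_Mapping.keys f.
      pm_scale (Poly_Mapping.lookup f u) (Poly_Mapping.single u (1::'k))) w = Poly_Mapping.lookup f w"
    by (simp add: lookup_sum lookup_pm_scale lookup_single when_def in_keys_iff if_distrib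
        cong: if_cong)
qed

section \<open>Multilinear operations\<close>

lemma listset_iff:
  "us \<in> listset As \<longleftrightarrow> length us = length As \<and> (\<forall>i<length As. us ! i \<in> As ! i)"
proof (induction As arbitrary: us)
  case (Cons A As)
  show ?case
    by (cases us) (auto simp: set_Cons_def Cons.IH nth_Cons All_less_Suc2 split: nat.splits)
qed auto

lemma finite_listset: "(\<And>A. A \<in> set As \<Longrightarrow> finite A) \<Longrightarrow> finite (listset As)"
proof (induction As)
  case (Cons A As)
  have "listset (A # As) = (\<lambda>(x, xs). x # xs) ` (A \<times> listset As)"
    by (auto simp: set_Cons_def)
  then show ?case using Cons by auto
qed auto

text \<open>
  Distributivity for a product of \<open>n\<close> sums, with the choices of summands recorded as lists; this is
  what lets \<open>omega_op\<close> commute with linear maps on its arguments.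
\<close>

lemma sum_listset_prod:
  fixes F :: "nat \<Rightarrow> 'a \<Rightarrow> 'k::comm_semiring_1"
  shows "(\<Sum>us\<in>listset As. \<Prod>i<length As. F i (us ! i)) = (\<Prod>i<length As. \<Sum>u\<in>As ! i. F i u)"
proof (induction As arbitrary: F)
  case (Cons A As)
  have eq: "listset (A # As) = (\<lambda>(x, xs). x # xs) ` (A \<times> listset As)"
    by (auto simp: set_Cons_def)
  have "(\<Sum>us\<in>listset (A # As). \<Prod>i<length (A # As). F i (us ! i)) =
      (\<Sum>(x, xs)\<in>A \<times> listset As. F 0 x * (\<Prod>i<length As. F (Suc i) (xs ! i)))"
    unfolding eq
    by (subst sum.reindex) (auto simp: inj_on_def prod.lessThan_Suc_shift case_prod_beta
        simp del: prod.lessThan_Suc)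
  also have "\<dots> = (\<Sum>x\<in>A. F 0 x) * (\<Sum>xs\<in>listset As. \<Prod>i<length As. F (Suc i) (xs ! i))"
    by (simp add: sum_product sum.cartesian_product)
  finally show ?case
    using Cons.IH[of "\<lambda>i. F (Suc i)"]
    by (simp add: prod.lessThan_Suc_shift del: prod.lessThan_Suc)
qed auto

text \<open>
  Each monomial \<open>Op \<nu> ws\<close> arises from exactly one choice of monomials in the arguments, so
  nothing is collected and its coefficient is a single product. This also covers lists \<open>ws\<close>
  outside the product of the supports, where some factor vanishes.
\<close>

lemma lookup_omega_op:
  "Poly_Mapping.lookup (omega_op \<nu> fs) (Op \<mu> ws) =
     (if \<mu> = \<nu> \<and> length ws = length fs
      then \<Prod>i<length fs. Poly_Mapping.lookup (fs ! i) (ws ! i) else 0)"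
proof -
  let ?D = "listset (map Poly_Mapping.keys fs)"
  let ?c = "\<lambda>us. \<Prod>i<length fs. Poly_Mapping.lookup (fs ! i) (us ! i)"
  have fin: "finite ?D" by (rule finite_listset) auto
  have "Poly_Mapping.lookup (omega_op \<nu> fs) (Op \<mu> ws) =
      (\<Sum>us\<in>?D. if us = ws then (if \<mu> = \<nu> then ?c ws else 0) else 0)"
    unfolding omega_op_def lookup_sum by (intro sum.cong) (auto simp: lookup_single when_def)
  also have "\<dots> = (if ws \<in> ?D \<and> \<mu> = \<nu> then ?c ws else 0)"
    using fin by simp
  also have "\<dots> = (if \<mu> = \<nu> \<and> length ws = length fs then ?c ws else 0)"
    by (auto simp: listset_iff in_keys_iff intro: prod_zero)
  finally show ?thesis .
qed

lemma lookup_omega_op_Gen [simp]: "Poly_Mapping.lookup (omega_op \<nu> fs) (Gen x) = 0"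
  by (simp add: omega_op_def lookup_sum lookup_single)

lemma omega_op_eq_0:
  assumes "j < length fs" "fs ! j = 0"
  shows "omega_op \<nu> fs = 0"
proof (rule poly_mapping_eqI)
  fix w
  show "Poly_Mapping.lookup (omega_op \<nu> fs) w = Poly_Mapping.lookup 0 w"
    using assms by (cases w) (auto simp: lookup_omega_op intro!: prod_zero bexI[of _ j])
qed

lemma keys_omega_op:
  "Poly_Mapping.keys (omega_op \<nu> fs) \<subseteq> Op \<nu> ` listset (map Poly_Mapping.keys fs)"
proof
  fix w assume w: "w \<in> Poly_Mapping.keys (omega_op \<nu> fs)"
  show "w \<in> Op \<nu> ` listset (map Poly_Mapping.keys fs)"
  proof (cases w)
    case (Op \<mu> ws)
    then have "\<mu> = \<nu>" "length ws = length fs"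
      "(\<Prod>i<length fs. Poly_Mapping.lookup (fs ! i) (ws ! i)) \<noteq> 0"
      using w by (auto simp: in_keys_iff lookup_omega_op split: if_splits)
    then show ?thesis using Op by (auto simp: listset_iff in_keys_iff)
  qed (use w in \<open>auto simp: in_keys_iff\<close>)
qed

text \<open>
  Generators have no arguments and are left unchanged, so that every monomial with normal arguments
  is fixed when \<open>h\<close> is the normal form.
\<close>

definition apply_arguments ::
  "(('f, 'x) oterm \<Rightarrow> ('f, 'x) oterm \<Rightarrow>\<^sub>0 'k::field) \<Rightarrow> ('f, 'x) oterm \<Rightarrow> ('f, 'x) oterm \<Rightarrow>\<^sub>0 'k" where
  "apply_arguments h u =
     (case u of Gen x \<Rightarrow> Poly_Mapping.single (Gen x) 1 | Op \<nu> us \<Rightarrow> omega_op \<nu> (map h us))"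

text \<open>
  On the span of the monomials with outermost symbol \<open>\<nu>\<close>, this is the tensor power of the
  linear extension of \<open>h\<close>.
\<close>

lemma linear_extension_apply_arguments:
  "linear_extension (apply_arguments h) (omega_op \<nu> fs) =
     omega_op \<nu> (map (linear_extension h) fs)"
proof (rule poly_mapping_eqI)
  fix w
  let ?D = "listset (map Poly_Mapping.keys fs)"
  let ?c = "\<lambda>us. \<Prod>i<length fs. Poly_Mapping.lookup (fs ! i) (us ! i)"
  have len: "length us = length fs" if "us \<in> ?D" for us
    using that by (simp add: listset_iff)
  have L: "Poly_Mapping.lookup (linear_extension (apply_arguments h) (omega_op \<nu> fs)) w =
      (\<Sum>us\<in>?D. ?c us * Poly_Mapping.lookup (omega_op \<nu> (map h us)) w)"
    by (simp add: omega_op_def[of \<nu> fs] linear_extension_sum linear_extension_single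
        lookup_sum lookup_pm_scale apply_arguments_def)
  show "Poly_Mapping.lookup (linear_extension (apply_arguments h) (omega_op \<nu> fs)) w =
      Poly_Mapping.lookup (omega_op \<nu> (map (linear_extension h) fs)) w"
  proof (cases w)
    case (Op \<mu> ws)
    show ?thesis
    proof (cases "\<mu> = \<nu> \<and> length ws = length fs")
      case True
      let ?F = "\<lambda>i u. Poly_Mapping.lookup (fs ! i) u * Poly_Mapping.lookup (h u) (ws ! i)"
      have "(\<Sum>us\<in>?D. ?c us * Poly_Mapping.lookup (omega_op \<nu> (map h us)) w) =
          (\<Sum>us\<in>?D. \<Prod>i<length (map Poly_Mapping.keys fs). ?F i (us ! i))"
        using True len by (intro sum.cong) (auto simp: Op lookup_omega_op prod.distrib)
      also have "\<dots> = (\<Prod>i<length fs. \<Sum>u\<in>Poly_Mapping.keys (fs ! i). ?F i u)"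
        by (subst sum_listset_prod) simp
      finally show ?thesis
        using True unfolding L by (simp add: Op lookup_omega_op lookup_linear_extension)
    next
      case False
      then show ?thesis unfolding L using len by (auto simp: Op lookup_omega_op intro!: sum.neutral)
    qed
  qed (use L in simp)
qed

section \<open>Admissible orderings and leading terms\<close>

locale admissible =
  fixes \<Omega> :: "'f set" and ar :: "'f \<Rightarrow> nat" and X :: "'x set" and r :: "('f, 'x) oterm rel"
  assumes admissible: "admissible_ordering \<Omega> ar X r"
begin

abbreviation magma where "magma \<equiv> omega_magma \<Omega> ar X"

lemma well_order: "well_order_on magma r"
  using admissible by (simp add: admissible_ordering_def)

lemma r_refl: "u \<in> magma \<Longrightarrow> (u, u) \<in> r"
  using well_order
  by (auto simp: well_order_on_def linear_order_on_def partial_order_on_def preorder_on_def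
      refl_on_def)

lemma r_total: "u \<in> magma \<Longrightarrow> v \<in> magma \<Longrightarrow> (u, v) \<in> r \<or> (v, u) \<in> r"
  using well_order r_refl
  by (cases "u = v") (auto simp: well_order_on_def linear_order_on_def total_on_def)

lemma r_trans: "(u, v) \<in> r \<Longrightarrow> (v, w) \<in> r \<Longrightarrow> (u, w) \<in> r"
  using well_order
  by (auto simp: well_order_on_def linear_order_on_def partial_order_on_def preorder_on_def
      elim: transE)

lemma r_antisym: "(u, v) \<in> r \<Longrightarrow> (v, u) \<in> r \<Longrightarrow> u = v"
  using well_order
  by (auto simp: well_order_on_def linear_order_on_def partial_order_on_def dest: antisymD)

lemma wf_r: "wf (r - Id)"
  using well_order by (simp add: well_order_on_def)

lemma r_Op_update:
  assumes "\<nu> \<in> \<Omega>" "ws \<in> lists magma" "length ws = ar \<nu>" "j < length ws" "(u, v) \<in> r"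
    and "u \<in> magma"
  shows "(Op \<nu> (ws[j := u]), Op \<nu> (ws[j := v])) \<in> r"
proof (cases "u = v")
  case True
  have "set (ws[j := u]) \<subseteq> magma"
    using assms by (intro set_update_subsetI) auto
  then have "Op \<nu> (ws[j := u]) \<in> magma"
    using assms by (intro omega_magma.Op) auto
  then show ?thesis using True r_refl by simp
next
  case False
  then show ?thesis using admissible assms unfolding admissible_ordering_def by blast
qed

text \<open>
  Admissibility compares words that differ in one argument; the arguments of \<open>vs\<close> are exchanged
  for those of \<open>ws\<close> one position at a time, from the left.
\<close>

lemma r_Op_mono:
  assumes "\<nu> \<in> \<Omega>" "ws \<in> lists magma" "vs \<in> lists magma" "length ws = ar \<nu>" "length vs = ar \<nu>"
    and le: "\<And>i. i < ar \<nu> \<Longrightarrow> (ws ! i, vs ! i) \<in> r"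
  shows "(Op \<nu> ws, Op \<nu> vs) \<in> r"
proof -
  have "(Op \<nu> (take k ws @ drop k vs), Op \<nu> vs) \<in> r" if "k \<le> ar \<nu>" for k
    using that
  proof (induction k)
    case 0
    have "Op \<nu> vs \<in> magma" using assms by (intro omega_magma.Op) auto
    then show ?case by (simp add: r_refl)
  next
    case (Suc k)
    let ?m = "take k ws @ drop k vs"
    have k: "k < ar \<nu>" using Suc by simp
    have m: "?m \<in> lists magma"
      using assms by (auto dest: in_set_takeD in_set_dropD)
    have e1: "?m[k := vs ! k] = ?m"
      using k assms by (simp add: nth_append list_update_append Cons_nth_drop_Suc list_update_same_conv)
    have e2: "?m[k := ws ! k] = take (Suc k) ws @ drop (Suc k) vs"
      using k assms
      by (intro nth_equalityI) (auto simp: nth_append nth_list_update less_Suc_eq)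
    have "(Op \<nu> (?m[k := ws ! k]), Op \<nu> (?m[k := vs ! k])) \<in> r"
      using assms k m by (intro r_Op_update) auto
    then show ?case
      using Suc.IH k r_trans unfolding e1 e2 by auto
  qed
  from this[of "ar \<nu>"] show ?thesis using assms by simp
qed

lemma finite_has_greatest:
  assumes "finite U" "U \<noteq> {}" "U \<subseteq> magma"
  shows "\<exists>u\<in>U. \<forall>v\<in>U. (v, u) \<in> r"
  using assms
proof (induction U rule: finite_ne_induct)
  case (insert x F)
  then obtain u where u: "u \<in> F" "\<forall>v\<in>F. (v, u) \<in> r" by auto
  have "(x, u) \<in> r \<or> (u, x) \<in> r" using r_total[of x u] insert.prems u(1) by blast
  then show ?case
  proof
    assume "(u, x) \<in> r"
    then have "\<forall>v\<in>insert x F. (v, x) \<in> r"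
      using u insert.prems r_refl r_trans by blast
    then show ?thesis by blast
  qed (use u in auto)
qed (auto intro: r_refl)

lemma leading_term_eqI:
  assumes "u \<in> Poly_Mapping.keys f" "\<And>v. v \<in> Poly_Mapping.keys f \<Longrightarrow> (v, u) \<in> r"
  shows "leading_term r f = u"
  unfolding leading_term_def using assms r_antisym by (intro the_equality) auto

lemma leading_term_greatest:
  assumes "Poly_Mapping.keys f \<subseteq> magma" "f \<noteq> 0"
  shows "leading_term r f \<in> Poly_Mapping.keys f"
    and "v \<in> Poly_Mapping.keys f \<Longrightarrow> (v, leading_term r f) \<in> r"
proof -
  obtain u where "u \<in> Poly_Mapping.keys f" "\<forall>v\<in>Poly_Mapping.keys f. (v, u) \<in> r"
    using finite_has_greatest[of "Poly_Mapping.keys f"] assms by auto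
  then show "leading_term r f \<in> Poly_Mapping.keys f"
    and "v \<in> Poly_Mapping.keys f \<Longrightarrow> (v, leading_term r f) \<in> r"
    using leading_term_eqI[of u f] by auto
qed

end

section \<open>Normal forms modulo an ideal\<close>

locale admissible_ideal = admissible \<Omega> ar X r
  for \<Omega> :: "'f set" and ar and X :: "'x set" and r +
  fixes J :: "(('f, 'x) oterm \<Rightarrow>\<^sub>0 'k::field) set"
  assumes ideal: "omega_ideal \<Omega> ar X J"
begin

lemma J_keys: "f \<in> J \<Longrightarrow> Poly_Mapping.keys f \<subseteq> magma"
  using ideal by (auto simp: omega_ideal_def free_omega_algebra_def)

lemma J_subspace: "pm_vs.subspace J"
  using ideal by (simp add: omega_ideal_def)

definition leading_terms where
  "leading_terms = {leading_term r f | f. f \<in> J \<and> f \<noteq> 0}"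

text \<open>
  The span of the normal monomials meets \<open>J\<close> only in 0; this makes normal forms unique.
\<close>

lemma zero_if_normal:
  assumes "f \<in> J" "Poly_Mapping.keys f \<inter> leading_terms = {}"
  shows "f = 0"
  using assms leading_term_greatest(1)[OF J_keys, of f] by (auto simp: leading_terms_def)

text \<open>
  Well-founded induction along the ordering: a monomial that is a leading term is congruent modulo
  \<open>J\<close> to a combination of smaller monomials. Besides existence, the later arguments need
  that the normal form involves no monomial above \<open>u\<close>, and that a normal monomial is its own
  normal form.
\<close>

lemma normal_form_exists:
  assumes "u \<in> magma"
  shows "\<exists>n. Poly_Mapping.keys n \<inter> leading_terms = {} \<and>
           (\<forall>v\<in>Poly_Mapping.keys n. v \<in> magma \<and> (v, u) \<in> r) \<and>
           Poly_Mapping.single u 1 - n \<in> J \<and> (u \<notin> leading_terms \<longrightarrow> n = Poly_Mapping.single u 1)"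
  using assms
proof (induction u rule: wf_induct_rule[OF wf_r])
  case (1 u)
  show ?case
  proof (cases "u \<in> leading_terms")
    case False
    then show ?thesis
      using 1 J_subspace by (intro exI[of _ "Poly_Mapping.single u 1"])
        (auto simp: r_refl pm_vs.subspace_0)
  next
    case True
    then obtain f where f: "f \<in> J" "f \<noteq> 0" and u: "u = leading_term r f"
      by (auto simp: leading_terms_def)
    note lt = leading_term_greatest[OF J_keys[OF f(1)] f(2), folded u]
    let ?V = "Poly_Mapping.keys f - {u}"
    have "\<forall>v\<in>?V. \<exists>n. Poly_Mapping.keys n \<inter> leading_terms = {} \<and>
        (\<forall>w\<in>Poly_Mapping.keys n. w \<in> magma \<and> (w, v) \<in> r) \<and> Poly_Mapping.single v 1 - n \<in> J"
      using 1 lt J_keys[OF f(1)] by blast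
    then obtain N where N: "\<And>v. v \<in> ?V \<Longrightarrow> Poly_Mapping.keys (N v) \<inter> leading_terms = {}"
      "\<And>v w. v \<in> ?V \<Longrightarrow> w \<in> Poly_Mapping.keys (N v) \<Longrightarrow> w \<in> magma \<and> (w, v) \<in> r"
      "\<And>v. v \<in> ?V \<Longrightarrow> Poly_Mapping.single v 1 - N v \<in> J"
      by metis
    define a where "a = Poly_Mapping.lookup f u"
    have a: "a \<noteq> 0" using lt(1) by (simp add: a_def in_keys_iff)
    \<comment> \<open>Solving \<open>f = 0\<close> for \<open>u\<close> gives \<open>t\<close>, whose monomials lie below \<open>u\<close> and so have normal forms.\<close>
    define t where "t = Poly_Mapping.single u 1 - pm_scale (inverse a) f"
    have "Poly_Mapping.lookup t v = 0" if "v \<notin> ?V" for v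
      using that a by (auto simp: t_def lookup_minus lookup_single lookup_pm_scale a_def in_keys_iff when_def)
    then have t: "Poly_Mapping.keys t \<subseteq> ?V" by (auto simp: in_keys_iff)
    let ?n = "linear_extension N t"
    have kn: "Poly_Mapping.keys ?n \<subseteq> (\<Union>v\<in>?V. Poly_Mapping.keys (N v))"
      using keys_linear_extension[of N t] t by blast
    have "t - ?n = (\<Sum>v\<in>Poly_Mapping.keys t.
        pm_scale (Poly_Mapping.lookup t v) (Poly_Mapping.single v 1 - N v))"
      using monomial_expansion[of t]
      by (simp add: linear_extension_def pm_vs.scale_right_diff_distrib sum_subtractf)
    also have "\<dots> \<in> J"
      using N(3) t by (intro pm_vs.subspace_sum pm_vs.subspace_scale J_subspace) auto
    finally have "pm_scale (inverse a) f + (t - ?n) \<in> J"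
      using f by (intro pm_vs.subspace_add pm_vs.subspace_scale J_subspace)
    then have "Poly_Mapping.single u 1 - ?n \<in> J" by (simp add: t_def)
    moreover have "v \<in> magma \<and> (v, u) \<in> r" if "v \<in> Poly_Mapping.keys ?n" for v
      using that kn N(2) lt(2) r_trans by blast
    moreover have "Poly_Mapping.keys ?n \<inter> leading_terms = {}" using kn N(1) by blast
    ultimately show ?thesis using True by blast
  qed
qed

definition normal_form where
  "normal_form u = (SOME n. Poly_Mapping.keys n \<inter> leading_terms = {} \<and>
           (\<forall>v\<in>Poly_Mapping.keys n. v \<in> magma \<and> (v, u) \<in> r) \<and>
           Poly_Mapping.single u 1 - n \<in> J \<and> (u \<notin> leading_terms \<longrightarrow> n = Poly_Mapping.single u 1))"

lemma
  assumes "u \<in> magma"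
  shows normal_form_keys: "Poly_Mapping.keys (normal_form u) \<inter> leading_terms = {}"
    and normal_form_le: "v \<in> Poly_Mapping.keys (normal_form u) \<Longrightarrow> v \<in> magma \<and> (v, u) \<in> r"
    and normal_form_cong: "Poly_Mapping.single u 1 - normal_form u \<in> J"
    and normal_form_id: "u \<notin> leading_terms \<Longrightarrow> normal_form u = Poly_Mapping.single u 1"
  using someI_ex[OF normal_form_exists[OF assms], folded normal_form_def] by auto

text \<open>
  The normal form of \<open>f\<close> differs from \<open>f\<close> by an element of \<open>J\<close>, so for \<open>f \<in> J\<close> it lies in
  \<open>J\<close> and is spanned by normal monomials.
\<close>

lemma linear_extension_normal_form_eq_0:
  assumes "f \<in> J"
  shows "linear_extension normal_form f = 0"
proof (rule zero_if_normal)
  let ?n = "linear_extension normal_form f"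
  have "f - ?n = (\<Sum>v\<in>Poly_Mapping.keys f.
      pm_scale (Poly_Mapping.lookup f v) (Poly_Mapping.single v 1 - normal_form v))"
    using monomial_expansion[of f]
    by (simp add: linear_extension_def pm_vs.scale_right_diff_distrib sum_subtractf)
  also have "\<dots> \<in> J"
    using normal_form_cong J_keys[OF assms]
    by (intro pm_vs.subspace_sum pm_vs.subspace_scale J_subspace) auto
  finally have "f - ?n \<in> J" .
  from pm_vs.subspace_diff[OF J_subspace assms this] show "?n \<in> J" by simp
  show "Poly_Mapping.keys ?n \<inter> leading_terms = {}"
    using keys_linear_extension[of normal_form f] normal_form_keys J_keys[OF assms] by blast
qed

section \<open>Decomposable elements and minimal leading terms\<close>

definition decomposables where
  "decomposables = {omega_op \<nu> fs | \<nu> fs. \<nu> \<in> \<Omega> \<and> fs \<in> lists (free_omega_algebra \<Omega> ar X) \<and>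
     length fs = ar \<nu> \<and> (\<exists>j<length fs. fs ! j \<in> J)}"

lemma span_decomposables_subset: "pm_vs.span decomposables \<subseteq> J"
  using ideal by (intro pm_vs.span_minimal J_subspace) (auto simp: omega_ideal_def decomposables_def)

text \<open>
  It is enough to look at the immediate arguments: by admissibility every word over \<open>\<Omega>\<close> that contains
  a leading term of the ideal is itself a leading term, so these are the leading terms without
  proper subwords that are leading terms.
\<close>

definition minimal_leading_terms where
  "minimal_leading_terms =
     {u \<in> leading_terms. \<forall>\<nu> us. u = Op \<nu> us \<longrightarrow> set us \<inter> leading_terms = {}}"

lemma minimal_leading_term_subword:
  "u \<in> leading_terms \<Longrightarrow> \<exists>m\<in>minimal_leading_terms. m \<in> subwords u"
proof (induction u)
  case (Gen x)
  then show ?case by (auto simp: minimal_leading_terms_def)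
next
  case (Op \<nu> us)
  show ?case
  proof (cases "set us \<inter> leading_terms = {}")
    case True
    then show ?thesis using Op.prems by (auto simp: minimal_leading_terms_def)
  next
    case False
    then show ?thesis using Op.IH by fastforce
  qed
qed

lemma apply_normal_form_le:
  assumes "u \<in> magma" "v \<in> Poly_Mapping.keys (apply_arguments normal_form u)"
  shows "(v, u) \<in> r"
  using assms(1)
proof cases
  case (Gen x)
  then show ?thesis using assms r_refl by (simp add: apply_arguments_def)
next
  case (Op \<nu> us)
  obtain ws where ws: "v = Op \<nu> ws" "ws \<in> listset (map Poly_Mapping.keys (map normal_form us))"
    using assms(2) keys_omega_op[of \<nu> "map normal_form us"] Op by (auto simp: apply_arguments_def)
  have len: "length ws = length us" using ws(2) by (simp add: listset_iff)
  have w: "ws ! i \<in> magma \<and> (ws ! i, us ! i) \<in> r" if "i < length us" for i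
    using that Op ws(2) normal_form_le[of "us ! i" "ws ! i"] by (simp add: listset_iff)
  then show ?thesis
    unfolding ws(1) \<open>u = _\<close> using Op len w by (intro r_Op_mono) (auto simp: in_set_conv_nth)
qed

lemma apply_normal_form_minimal:
  assumes "u \<in> magma" "u \<in> minimal_leading_terms"
  shows "apply_arguments normal_form u = Poly_Mapping.single u 1"
  using assms(1)
proof cases
  case (Op \<nu> us)
  have "normal_form w = Poly_Mapping.single w 1" if "w \<in> set us" for w
    using that Op assms(2) by (intro normal_form_id) (auto simp: minimal_leading_terms_def)
  then have "map normal_form us = map (\<lambda>w. Poly_Mapping.single w 1) us" by simp
  then show ?thesis
    unfolding \<open>u = _\<close> apply_arguments_def oterm.case using omega_op_monomials by metis
qed (simp add: apply_arguments_def)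

lemma apply_normal_form_decomposables:
  assumes "f \<in> pm_vs.span decomposables"
  shows "linear_extension (apply_arguments normal_form) f = 0"
  using assms
proof (induction rule: pm_vs.span_induct)
  show "pm_vs.subspace {f. linear_extension (apply_arguments normal_form) f = 0}"
    by (intro pm_vs.subspaceI) (auto simp: linear_extension_add linear_extension_scale)
next
  fix f assume "f \<in> decomposables"
  then obtain \<nu> fs j where f: "f = omega_op \<nu> fs" and j: "j < length fs" "fs ! j \<in> J"
    by (auto simp: decomposables_def)
  show "linear_extension (apply_arguments normal_form) f = 0"
    unfolding f linear_extension_apply_arguments
    using j by (intro omega_op_eq_0[of j]) (auto simp: linear_extension_normal_form_eq_0)
qed

text \<open>
  Applying normal forms to arguments kills \<open>f\<close>, but would keep its leading coefficient if the
  leading term were minimal: monomials below the leading term cannot contribute to it.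
\<close>

lemma leading_term_decomposable_not_minimal:
  assumes f: "f \<in> pm_vs.span decomposables" "f \<noteq> 0"
  shows "leading_term r f \<notin> minimal_leading_terms"
proof
  assume min: "leading_term r f \<in> minimal_leading_terms"
  define u where "u = leading_term r f"
  have keys: "Poly_Mapping.keys f \<subseteq> magma"
    using f span_decomposables_subset J_keys by blast
  note lt = leading_term_greatest[OF keys f(2), folded u_def]
  let ?p = "apply_arguments normal_form"
  have "Poly_Mapping.lookup (?p v) u = 0" if "v \<in> Poly_Mapping.keys f - {u}" for v
  proof -
    have "(u, v) \<notin> r" using lt(2)[of v] r_antisym[of u v] that by auto
    moreover have "v \<in> magma" using keys that by auto
    ultimately show ?thesis using apply_normal_form_le[of v u] in_keys_iff by metis
  qed
  then have "Poly_Mapping.lookup (linear_extension ?p f) u =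
      (\<Sum>v\<in>{u}. Poly_Mapping.lookup f v * Poly_Mapping.lookup (?p v) u)"
    unfolding lookup_linear_extension using lt(1) by (intro sum.mono_neutral_right) auto
  also have "\<dots> = Poly_Mapping.lookup f u"
    using apply_normal_form_minimal[of u] min keys lt(1) by (auto simp: u_def)
  finally show False
    using apply_normal_form_decomposables[OF f(1)] lt(1) by (simp add: in_keys_iff)
qed

section \<open>Finiteness\<close>

text \<open>
  The span of \<open>S\<close> and the decomposable elements is an ideal because any operation with an argument
  in it, and hence in \<open>J\<close>, yields a decomposable element.
\<close>

lemma finitely_generated_decomposition:
  assumes S: "S \<subseteq> J" "\<And>I. omega_ideal \<Omega> ar X I \<Longrightarrow> S \<subseteq> I \<Longrightarrow> J \<subseteq> I"
    and f: "f \<in> J"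
  shows "\<exists>s\<in>pm_vs.span S. f - s \<in> pm_vs.span decomposables"
proof -
  let ?I = "pm_vs.span (S \<union> decomposables)"
  have IJ: "?I \<subseteq> J"
    using S(1) span_decomposables_subset pm_vs.span_superset[of decomposables]
    by (intro pm_vs.span_minimal J_subspace) auto
  have "omega_ideal \<Omega> ar X ?I"
    unfolding omega_ideal_def
  proof (intro conjI ballI impI)
    show "?I \<subseteq> free_omega_algebra \<Omega> ar X"
      using IJ ideal by (auto simp: omega_ideal_def)
    fix \<nu> fs assume "\<nu> \<in> \<Omega>" "fs \<in> lists (free_omega_algebra \<Omega> ar X)"
      "length fs = ar \<nu> \<and> (\<exists>j<length fs. fs ! j \<in> ?I)"
    then have "omega_op \<nu> fs \<in> decomposables"
      using IJ unfolding decomposables_def by blast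
    then show "omega_op \<nu> fs \<in> ?I" by (simp add: pm_vs.span_base)
  qed (rule pm_vs.subspace_span)
  then have "f \<in> ?I"
    using S(2) f pm_vs.span_superset[of "S \<union> decomposables"] by blast
  then obtain s t where "f = s + t" "s \<in> pm_vs.span S" "t \<in> pm_vs.span decomposables"
    by (auto simp: pm_vs.span_Un)
  then show ?thesis by (intro bexI[of _ s]) auto
qed

text \<open>
  Modulo decomposables, representatives \<open>g m\<close> of the minimal leading terms \<open>m\<close> may be replaced by
  elements \<open>s m\<close> of the finite-dimensional space \<open>span S\<close>. The \<open>s m\<close> are linearly independent: a
  relation among them turns the same combination of the \<open>g m\<close> into a decomposable element,
  whose leading term is the largest \<open>m\<close> with nonzero coefficient.
\<close>

lemma finite_minimal_leading_terms:
  assumes S: "finite S" "S \<subseteq> J" "\<And>I. omega_ideal \<Omega> ar X I \<Longrightarrow> S \<subseteq> I \<Longrightarrow> J \<subseteq> I"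
  shows "finite minimal_leading_terms"
proof -
  let ?M = minimal_leading_terms and ?D = "pm_vs.span decomposables"
  have "\<forall>m\<in>?M. \<exists>g. g \<in> J \<and> g \<noteq> 0 \<and> leading_term r g = m"
    by (auto simp: minimal_leading_terms_def leading_terms_def)
  then obtain g where g: "\<And>m. m \<in> ?M \<Longrightarrow> g m \<in> J \<and> g m \<noteq> 0 \<and> leading_term r (g m) = m"
    by metis
  have "\<exists>t. t \<in> pm_vs.span S \<and> g m - t \<in> ?D" if "m \<in> ?M" for m
    using finitely_generated_decomposition[OF S(2), of "g m"] S(3) g[OF that] by auto
  then obtain s where s: "\<And>m. m \<in> ?M \<Longrightarrow> s m \<in> pm_vs.span S \<and> g m - s m \<in> ?D"
    by metis
  have Mmag: "?M \<subseteq> magma"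
  proof
    fix m assume "m \<in> ?M"
    then show "m \<in> magma"
      using g[of m] leading_term_greatest(1)[of "g m"] J_keys[of "g m"] by auto
  qed
  have indep: "c m = 0"
    if T: "finite T" "T \<subseteq> ?M" "(\<Sum>m\<in>T. pm_scale (c m) (s m)) = 0" "m \<in> T" for T c m
  proof (rule ccontr)
    assume "c m \<noteq> 0"
    let ?U = "{m \<in> T. c m \<noteq> 0}"
    have "finite ?U" "?U \<noteq> {}" "?U \<subseteq> magma"
      using T Mmag \<open>c m \<noteq> 0\<close> by auto
    then obtain u where u: "u \<in> ?U" "\<And>v. v \<in> ?U \<Longrightarrow> (v, u) \<in> r"
      using finite_has_greatest[of ?U] by auto
    define f where "f = (\<Sum>m\<in>T. pm_scale (c m) (g m))"
    have "f = (\<Sum>m\<in>T. pm_scale (c m) (g m - s m))"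
      using T(3) by (simp add: f_def pm_vs.scale_right_diff_distrib sum_subtractf)
    also have "\<dots> \<in> ?D"
      using s T(2) by (intro pm_vs.span_sum pm_vs.span_scale) auto
    finally have fD: "f \<in> ?D" .
    have lk: "Poly_Mapping.lookup f w = (\<Sum>m\<in>T. c m * Poly_Mapping.lookup (g m) w)" for w
      by (simp add: f_def lookup_sum lookup_pm_scale)
    have le: "(w, v) \<in> r" if "v \<in> ?U" "Poly_Mapping.lookup (g v) w \<noteq> 0" for v w
    proof -
      have "v \<in> ?M" using that(1) T(2) by auto
      from g[OF this] that(2) leading_term_greatest(2)[OF J_keys, of "g v" w]
      show ?thesis by (simp add: in_keys_iff)
    qed
    have "Poly_Mapping.lookup (g v) u = 0" if "v \<in> ?U - {u}" for v
      using le[of v u] u(2)[of v] r_antisym[of u v] that by auto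
    then have "Poly_Mapping.lookup f u = (\<Sum>m\<in>{u}. c m * Poly_Mapping.lookup (g m) u)"
      unfolding lk using T(1) u(1) by (intro sum.mono_neutral_right) auto
    moreover have "Poly_Mapping.lookup (g u) u \<noteq> 0"
    proof -
      have "u \<in> ?M" using u(1) T(2) by auto
      from g[OF this] leading_term_greatest(1)[OF J_keys, of "g u"]
      show ?thesis by (simp add: in_keys_iff)
    qed
    ultimately have fu: "Poly_Mapping.lookup f u \<noteq> 0" using u(1) by simp
    have "(w, u) \<in> r" if "w \<in> Poly_Mapping.keys f" for w
    proof -
      have "(\<Sum>v\<in>T. c v * Poly_Mapping.lookup (g v) w) \<noteq> 0"
        using that by (simp add: in_keys_iff lk)
      then obtain v where "v \<in> T" "c v * Poly_Mapping.lookup (g v) w \<noteq> 0"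
        by (rule sum.not_neutral_contains_not_neutral)
      then show ?thesis using le[of v w] u(2)[of v] r_trans[of w v u] by auto
    qed
    then have "leading_term r f = u"
      using fu by (intro leading_term_eqI) (auto simp: in_keys_iff)
    moreover have "f \<noteq> 0" using fu by auto
    ultimately show False
      using leading_term_decomposable_not_minimal[OF fD] u(1) T(2) by auto
  qed
  have inj: "inj_on s ?M"
  proof (rule inj_onI, rule ccontr)
    fix a b assume ab: "a \<in> ?M" "b \<in> ?M" "s a = s b" "a \<noteq> b"
    \<comment> \<open>If \<open>s a = s b\<close>, then \<open>s a - s b = 0\<close> is a relation with coefficients 1 and -1.\<close>
    have "(if a = a then 1 else - 1) = (0::'k)"
      using ab by (intro indep[of "{a, b}" "\<lambda>m. if m = a then 1 else - 1"]) auto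
    then show False by simp
  qed
  have "\<not> pm_vs.dependent (s ` ?M)"
  proof
    assume "pm_vs.dependent (s ` ?M)"
    then obtain V c v where V: "finite V" "V \<subseteq> s ` ?M" "(\<Sum>v\<in>V. pm_scale (c v) v) = 0"
      "v \<in> V" "c v \<noteq> 0"
      unfolding pm_vs.dependent_explicit by blast
    obtain T where T: "T \<subseteq> ?M" "finite T" "V = s ` T"
      using finite_subset_image[OF V(1,2)] by auto
    have "inj_on s T" using inj T(1) by (rule inj_on_subset)
    then have "(\<Sum>m\<in>T. pm_scale (c (s m)) (s m)) = 0"
      using V(3) unfolding T(3) by (simp add: sum.reindex)
    moreover obtain m where "m \<in> T" "v = s m" using V(4) T(3) by auto
    ultimately show False using indep[of T "\<lambda>m. c (s m)" m] T(1,2) V(5) by simp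
  qed
  moreover have "s ` ?M \<subseteq> pm_vs.span S" using s by auto
  ultimately have "finite (s ` ?M)"
    using pm_vs.independent_span_bound[OF S(1)] by simp
  then show ?thesis using inj by (simp add: finite_image_iff)
qed

end

theorem proposition3p7:
  fixes \<Omega> :: "'f set" and ar :: "'f \<Rightarrow> nat" and X :: "'x set"
    and J :: "(('f, 'x) oterm \<Rightarrow>\<^sub>0 'k::field) set"
    and r :: "('f, 'x) oterm rel"
  assumes "omega_signature \<Omega> ar"
    and "fin_gen_omega_ideal \<Omega> ar X J"
    and "admissible_ordering \<Omega> ar X r"
  shows "\<exists>B. finite B \<and> groebner_basis r J B"
proof -
  interpret admissible_ideal \<Omega> ar X r J
  proof
    show "omega_ideal \<Omega> ar X J" using assms(2) by (simp add: fin_gen_omega_ideal_def)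
  qed (rule assms(3))
  obtain S where S: "finite S" "S \<subseteq> J" "\<forall>I. omega_ideal \<Omega> ar X I \<and> S \<subseteq> I \<longrightarrow> J \<subseteq> I"
    using assms(2) unfolding fin_gen_omega_ideal_def by auto
  have "\<forall>m\<in>minimal_leading_terms. \<exists>g. g \<in> J \<and> g \<noteq> 0 \<and> leading_term r g = m"
    by (auto simp: minimal_leading_terms_def leading_terms_def)
  then obtain g where g: "\<And>m. m \<in> minimal_leading_terms \<Longrightarrow>
      g m \<in> J \<and> g m \<noteq> 0 \<and> leading_term r (g m) = m"
    by metis
  have "groebner_basis r J (g ` minimal_leading_terms)"
    unfolding groebner_basis_def
  proof (intro conjI ballI impI)
    fix f assume "f \<in> J" "f \<noteq> 0"
    then have "leading_term r f \<in> leading_terms" by (auto simp: leading_terms_def)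
    then obtain m where "m \<in> minimal_leading_terms" "m \<in> subwords (leading_term r f)"
      using minimal_leading_term_subword by blast
    with g[of m]
    show "\<exists>h\<in>g ` minimal_leading_terms. h \<noteq> 0 \<and> leading_term r h \<in> subwords (leading_term r f)"
      by (intro bexI[of _ "g m"]) auto
  next
    show "g ` minimal_leading_terms \<subseteq> J" using g by blast
  qed
  moreover have "finite minimal_leading_terms"
    using S by (intro finite_minimal_leading_terms[of S]) auto
  ultimately show ?thesis by (intro exI[of _ "g ` minimal_leading_terms"]) simp
qed

end
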